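(* Let $(M,\mathcal{D},J,\theta)$ be a pseudo-Hermitian manifold. Then the Tanaka--Webster connection $\nabla^{TW}$ coincides with the adapted connection $\nabla^{\boldsymbol\tau}$.
   Context: Convention: $\mathrm{d}\theta(X,Y)=X\theta(Y)-Y\theta(X)-\theta([X,Y])$. A pseudo-Hermitian manifold is a smooth manifold $M$ of dimension $2m+1\ge3$ with a contact form $\theta$, contact distribution $\mathcal{D}=\ker\theta$, and a complex structure $J:\mathcal{D}\to\mathcal{D}$ such that $[X,JY]+[JX,Y]\in\Gamma(\mathcal{D})$ and $[X,Y]-[JX,JY]+J([X,JY]+[JX,Y])=0$ for all $X,Y\in\Gamma(\mathcal{D})$, and such that $g=\mathrm{d}\theta(\cdot,J\cdot)$ is positive definite on $\mathcal{D}$. The Reeb vector field $\xi$: $\theta(\xi)=1$, $\iota_\xi\mathrm{d}\theta=0$; $\pi=\mathrm{Id}-\theta\otimes\xi:TM\to\mathcal{D}$. The Schouten connection $\nabla$ is the unique partial connection $\Gamma(\mathcal D)\to\Gamma(\mathcal D^*\otimes\mathcal D)$ with $\nabla g=0$ and $\nabla_XY-\nabla_YX=\pi[X,Y]$ for $X,Y\in\Gamma(\mathcal{D})$ (equivalently, given by the Koszul formula $2g(\nabla_XY,Z)=Xg(Y,Z)+Yg(Z,X)-Zg(X,Y)+g(\pi[X,Y],Z)-g(\pi[Y,Z],X)-g(\pi[X,Z],Y)$). The Tanaka--Webster connection $\nabla^{TW}$ is the connection on the vector bundle $\mathcal{D}\to M$ satisfying this Koszul formula for $X,Y,Z\in\Gamma(\mathcal{D})$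 and $\nabla^{TW}_\xi X=\frac12([\xi,X]-J[\xi,JX])$ for $X\in\Gamma(\mathcal{D})$. The adapted connection $\nabla^{\boldsymbol\tau}$ is the connection on $\mathcal{D}\to M$ with $\nabla^{\boldsymbol\tau}_XY=\nabla_XY$ for $X,Y\in\Gamma(\mathcal{D})$ and $\nabla^{\boldsymbol\tau}_\xi X=[\xi,X]+\boldsymbol\tau(X)$, where $\boldsymbol\tau$ is the symmetric endomorphism of $\mathcal{D}$ with $g(\boldsymbol\tau X,Y)=\frac12(\mathcal{L}_\xi g)(X,Y)$. *)

theory Defs
  imports
    "HOL-Analysis.Analysis"
    "HOL-Library.Function_Algebras"
    "HOL-Combinatorics.Permutations"
begin

section \<open>Smooth manifolds\<close>

primrec Ck_on ::
  "nat \<Rightarrow> 'e::real_normed_vector set \<Rightarrow> ('e \<Rightarrow> 'f::real_normed_vector) \<Rightarrow> bool"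
where
  "Ck_on 0 S f \<longleftrightarrow> continuous_on S f"
| "Ck_on (Suc k) S f \<longleftrightarrow>
     (\<forall>x\<in>S. f differentiable (at x)) \<and> (\<forall>v. Ck_on k S (\<lambda>x. frechet_derivative f (at x) v))"

text \<open>Only used for open \<open>S\<close> in a finite-dimensional space, where the directional
  derivatives in all directions control the Frechet derivative.\<close>

definition smooth_on ::
  "'e::real_normed_vector set \<Rightarrow> ('e \<Rightarrow> 'f::real_normed_vector) \<Rightarrow> bool" where
  "smooth_on S f \<longleftrightarrow> (\<forall>k. Ck_on k S f)"

text \<open>A chart is a pair of a domain and a coordinate map; the map is only relevant on the domain.
  The atlas need not be maximal. The dimension of the manifold is \<open>DIM('e)\<close>.\<close>

locale smooth_manifold =
  fixes M :: "'a topology"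
    and atlas :: "('a set \<times> ('a \<Rightarrow> 'e::euclidean_space)) set"
  assumes Hausdorff: "Hausdorff_space M"
    and second_countable:
      "\<exists>\<B>. countable \<B> \<and> (\<forall>V\<in>\<B>. openin M V) \<and>
         (\<forall>U x. openin M U \<and> x \<in> U \<longrightarrow> (\<exists>V\<in>\<B>. x \<in> V \<and> V \<subseteq> U))"
    and atlas_covers: "(\<Union>(U, \<phi>)\<in>atlas. U) = topspace M"
    and chart: "(U, \<phi>) \<in> atlas \<Longrightarrow>
      openin M U \<and> open (\<phi> ` U) \<and>
      homeomorphic_map (subtopology M U) (top_of_set (\<phi> ` U)) \<phi>"
    and smooth_transition: "(U, \<phi>) \<in> atlas \<Longrightarrow> (V, \<psi>) \<in> atlas \<Longrightarrow>
      smooth_on (\<phi> ` (U \<inter> V)) (\<psi> \<circ> inv_into U \<phi>)"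

text \<open>Functions on \<open>M\<close> are extended by zero outside \<open>topspace M\<close>, tangent vectors (derivations at
  a point) by zero to non-smooth functions, and vector fields by zero outside \<open>topspace M\<close>;
  thus equality in HOL is equality on \<open>M\<close>. Sums, products and numerals of functions are pointwise.\<close>

type_synonym 'a tvec = "('a \<Rightarrow> real) \<Rightarrow> real"
type_synonym 'a vfield = "'a \<Rightarrow> 'a tvec"

definition vf_act :: "'a vfield \<Rightarrow> ('a \<Rightarrow> real) \<Rightarrow> ('a \<Rightarrow> real)" where
  "vf_act X f = (\<lambda>p. X p f)"

definition vf_scale :: "('a \<Rightarrow> real) \<Rightarrow> 'a vfield \<Rightarrow> 'a vfield" (infixr "*\<^sub>F" 75) where
  "f *\<^sub>F X = (\<lambda>p h. f p * X p h)"

definition lie_bracket :: "'a vfield \<Rightarrow> 'a vfield \<Rightarrow> 'a vfield" where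
  "lie_bracket X Y = (\<lambda>p f. X p (vf_act Y f) - Y p (vf_act X f))"

context smooth_manifold
begin

definition smooth_functions :: "('a \<Rightarrow> real) set" where
  "smooth_functions = {f. (\<forall>p. p \<notin> topspace M \<longrightarrow> f p = 0) \<and>
     (\<forall>(U, \<phi>)\<in>atlas. smooth_on (\<phi> ` U) (f \<circ> inv_into U \<phi>))}"

definition tangent_space :: "'a \<Rightarrow> 'a tvec set" where
  "tangent_space p = {v.
     (\<forall>f. f \<notin> smooth_functions \<longrightarrow> v f = 0) \<and>
     (\<forall>f\<in>smooth_functions. \<forall>h\<in>smooth_functions. v (f + h) = v f + v h) \<and>
     (\<forall>c. \<forall>f\<in>smooth_functions. v (\<lambda>q. c * f q) = c * v f) \<and>
     (\<forall>f\<in>smooth_functions. \<forall>h\<in>smooth_functions. v (f * h) = f p * v h + h p * v f)}"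

definition vector_fields :: "'a vfield set" where
  "vector_fields = {X. (\<forall>p\<in>topspace M. X p \<in> tangent_space p) \<and>
     (\<forall>p. p \<notin> topspace M \<longrightarrow> X p = 0) \<and>
     (\<forall>f\<in>smooth_functions. vf_act X f \<in> smooth_functions)}"

definition form_app :: "('a \<Rightarrow> 'a tvec \<Rightarrow> real) \<Rightarrow> 'a vfield \<Rightarrow> ('a \<Rightarrow> real)" where
  "form_app \<theta> X = (\<lambda>p. if p \<in> topspace M then \<theta> p (X p) else 0)"

definition endo_app :: "('a \<Rightarrow> 'a tvec \<Rightarrow> 'a tvec) \<Rightarrow> 'a vfield \<Rightarrow> 'a vfield" where
  "endo_app T X = (\<lambda>p. if p \<in> topspace M then T p (X p) else 0)"

definition one_form :: "('a \<Rightarrow> 'a tvec \<Rightarrow> real) \<Rightarrow> bool" where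
  "one_form \<theta> \<longleftrightarrow>
     (\<forall>p\<in>topspace M. \<forall>u\<in>tangent_space p. \<forall>v\<in>tangent_space p. \<theta> p (u + v) = \<theta> p u + \<theta> p v) \<and>
     (\<forall>p\<in>topspace M. \<forall>c. \<forall>u\<in>tangent_space p. \<theta> p (\<lambda>h. c * u h) = c * \<theta> p u) \<and>
     (\<forall>X\<in>vector_fields. form_app \<theta> X \<in> smooth_functions)"

definition ext_deriv ::
  "('a \<Rightarrow> 'a tvec \<Rightarrow> real) \<Rightarrow> 'a vfield \<Rightarrow> 'a vfield \<Rightarrow> ('a \<Rightarrow> real)" where
  "ext_deriv \<theta> X Y =
     vf_act X (form_app \<theta> Y) - vf_act Y (form_app \<theta> X) - form_app \<theta> (lie_bracket X Y)"

text \<open>\<open>\<theta> \<and> (d\<theta>)\<^sup>m\<close> evaluated on \<open>X 0, \<dots>, X (2 * m)\<close>, up to a positive constant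
  depending only on \<open>m\<close> and on the normalisation of the wedge product.\<close>

definition contact_volume ::
  "nat \<Rightarrow> ('a \<Rightarrow> 'a tvec \<Rightarrow> real) \<Rightarrow> (nat \<Rightarrow> 'a vfield) \<Rightarrow> ('a \<Rightarrow> real)" where
  "contact_volume m \<theta> X = (\<lambda>p. \<Sum>\<sigma> | \<sigma> permutes {..2 * m}.
     of_int (sign \<sigma>) * form_app \<theta> (X (\<sigma> 0)) p *
     (\<Prod>i=1..m. ext_deriv \<theta> (X (\<sigma> (2 * i - 1))) (X (\<sigma> (2 * i))) p))"

definition contact_form :: "nat \<Rightarrow> ('a \<Rightarrow> 'a tvec \<Rightarrow> real) \<Rightarrow> bool" where
  "contact_form m \<theta> \<longleftrightarrow> one_form \<theta> \<and>
     (\<forall>p\<in>topspace M. \<exists>X. (\<forall>i\<le>2 * m. X i \<in> vector_fields) \<and> contact_volume m \<theta> X p \<noteq> 0)"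

definition contact_dist :: "('a \<Rightarrow> 'a tvec \<Rightarrow> real) \<Rightarrow> 'a \<Rightarrow> 'a tvec set" where
  "contact_dist \<theta> p = {v \<in> tangent_space p. \<theta> p v = 0}"

definition dist_sections :: "('a \<Rightarrow> 'a tvec \<Rightarrow> real) \<Rightarrow> 'a vfield set" where
  "dist_sections \<theta> = {X \<in> vector_fields. \<forall>p\<in>topspace M. X p \<in> contact_dist \<theta> p}"

definition dist_endo ::
  "('a \<Rightarrow> 'a tvec \<Rightarrow> real) \<Rightarrow> ('a \<Rightarrow> 'a tvec \<Rightarrow> 'a tvec) \<Rightarrow> bool" where
  "dist_endo \<theta> T \<longleftrightarrow>
     (\<forall>p\<in>topspace M. \<forall>u\<in>contact_dist \<theta> p. T p u \<in> contact_dist \<theta> p) \<and>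
     (\<forall>p\<in>topspace M. \<forall>u\<in>contact_dist \<theta> p. \<forall>v\<in>contact_dist \<theta> p. T p (u + v) = T p u + T p v) \<and>
     (\<forall>p\<in>topspace M. \<forall>c. \<forall>u\<in>contact_dist \<theta> p. T p (\<lambda>h. c * u h) = (\<lambda>h. c * T p u h)) \<and>
     (\<forall>X\<in>dist_sections \<theta>. endo_app T X \<in> dist_sections \<theta>)"

definition reeb_field :: "('a \<Rightarrow> 'a tvec \<Rightarrow> real) \<Rightarrow> 'a vfield \<Rightarrow> bool" where
  "reeb_field \<theta> \<xi> \<longleftrightarrow> \<xi> \<in> vector_fields \<and> (\<forall>p\<in>topspace M. \<theta> p (\<xi> p) = 1) \<and>
     (\<forall>X\<in>vector_fields. ext_deriv \<theta> \<xi> X = 0)"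

definition dist_proj ::
  "('a \<Rightarrow> 'a tvec \<Rightarrow> real) \<Rightarrow> 'a vfield \<Rightarrow> 'a vfield \<Rightarrow> 'a vfield" where
  "dist_proj \<theta> \<xi> X = X - form_app \<theta> X *\<^sub>F \<xi>"

end

section \<open>Pseudo-Hermitian manifolds\<close>

text \<open>Since \<open>g = d\<theta>(\<cdot>, J \<cdot>)\<close> is tensorial and every vector of \<open>\<D>\<close> extends to a section,
  positive definiteness on each fibre is expressed through values of sections.\<close>

locale pseudo_hermitian_manifold = smooth_manifold M atlas
  for M :: "'a topology" and atlas :: "('a set \<times> ('a \<Rightarrow> 'e::euclidean_space)) set" +
  fixes m :: nat
    and \<theta> :: "'a \<Rightarrow> 'a tvec \<Rightarrow> real"
    and J :: "'a \<Rightarrow> 'a tvec \<Rightarrow> 'a tvec"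
  assumes m_pos: "m \<ge> 1"
    and dimension: "DIM('e) = 2 * m + 1"
    and contact: "contact_form m \<theta>"
    and J_endo: "dist_endo \<theta> J"
    and J_square: "p \<in> topspace M \<Longrightarrow> v \<in> contact_dist \<theta> p \<Longrightarrow> J p (J p v) = - v"
    and partially_integrable: "X \<in> dist_sections \<theta> \<Longrightarrow> Y \<in> dist_sections \<theta> \<Longrightarrow>
      lie_bracket X (endo_app J Y) + lie_bracket (endo_app J X) Y \<in> dist_sections \<theta>"
    and integrable: "X \<in> dist_sections \<theta> \<Longrightarrow> Y \<in> dist_sections \<theta> \<Longrightarrow>
      lie_bracket X Y - lie_bracket (endo_app J X) (endo_app J Y) +
      endo_app J (lie_bracket X (endo_app J Y) + lie_bracket (endo_app J X) Y) = 0"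
    and positive_definite: "X \<in> dist_sections \<theta> \<Longrightarrow> p \<in> topspace M \<Longrightarrow> X p \<noteq> 0 \<Longrightarrow>
      ext_deriv \<theta> X (endo_app J X) p > 0"
begin

abbreviation sections_D :: "'a vfield set" where
  "sections_D \<equiv> dist_sections \<theta>"

definition webster_metric :: "'a vfield \<Rightarrow> 'a vfield \<Rightarrow> ('a \<Rightarrow> real)" where
  "webster_metric X Y = ext_deriv \<theta> X (endo_app J Y)"

definition lie_webster_metric :: "'a vfield \<Rightarrow> 'a vfield \<Rightarrow> 'a vfield \<Rightarrow> ('a \<Rightarrow> real)" where
  "lie_webster_metric \<xi> X Y =
     vf_act \<xi> (webster_metric X Y) - webster_metric (lie_bracket \<xi> X) Y - webster_metric X (lie_bracket \<xi> Y)"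

text \<open>Covariant differentiation of sections of \<open>\<D>\<close> in directions taken from \<open>\<V>\<close>: this is a
  connection on \<open>\<D> \<rightarrow> M\<close> for \<open>\<V> = vector_fields\<close> and a partial connection for
  \<open>\<V> = sections_D\<close>.\<close>

definition covariant_derivative ::
  "'a vfield set \<Rightarrow> ('a vfield \<Rightarrow> 'a vfield \<Rightarrow> 'a vfield) \<Rightarrow> bool" where
  "covariant_derivative \<V> nabla \<longleftrightarrow>
     (\<forall>V\<in>\<V>. \<forall>Y\<in>sections_D. nabla V Y \<in> sections_D) \<and>
     (\<forall>V\<in>\<V>. \<forall>W\<in>\<V>. \<forall>Y\<in>sections_D. nabla (V + W) Y = nabla V Y + nabla W Y) \<and>
     (\<forall>f\<in>smooth_functions. \<forall>V\<in>\<V>. \<forall>Y\<in>sections_D. nabla (f *\<^sub>F V) Y = f *\<^sub>F nabla V Y) \<and>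
     (\<forall>V\<in>\<V>. \<forall>Y\<in>sections_D. \<forall>Z\<in>sections_D. nabla V (Y + Z) = nabla V Y + nabla V Z) \<and>
     (\<forall>f\<in>smooth_functions. \<forall>V\<in>\<V>. \<forall>Y\<in>sections_D.
        nabla V (f *\<^sub>F Y) = vf_act V f *\<^sub>F Y + f *\<^sub>F nabla V Y)"

definition schouten_connection ::
  "'a vfield \<Rightarrow> ('a vfield \<Rightarrow> 'a vfield \<Rightarrow> 'a vfield) \<Rightarrow> bool" where
  "schouten_connection \<xi> nabla \<longleftrightarrow> covariant_derivative sections_D nabla \<and>
     (\<forall>X\<in>sections_D. \<forall>Y\<in>sections_D. \<forall>Z\<in>sections_D.
        vf_act X (webster_metric Y Z) = webster_metric (nabla X Y) Z + webster_metric Y (nabla X Z)) \<and>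
     (\<forall>X\<in>sections_D. \<forall>Y\<in>sections_D.
        nabla X Y - nabla Y X = dist_proj \<theta> \<xi> (lie_bracket X Y))"

definition koszul_formula ::
  "'a vfield \<Rightarrow> ('a vfield \<Rightarrow> 'a vfield \<Rightarrow> 'a vfield) \<Rightarrow> bool" where
  "koszul_formula \<xi> nabla \<longleftrightarrow>
     (\<forall>X\<in>sections_D. \<forall>Y\<in>sections_D. \<forall>Z\<in>sections_D.
        2 * webster_metric (nabla X Y) Z =
          vf_act X (webster_metric Y Z) + vf_act Y (webster_metric Z X) - vf_act Z (webster_metric X Y)
          + webster_metric (dist_proj \<theta> \<xi> (lie_bracket X Y)) Z
          - webster_metric (dist_proj \<theta> \<xi> (lie_bracket Y Z)) X
          - webster_metric (dist_proj \<theta> \<xi> (lie_bracket X Z)) Y)"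

definition tanaka_webster ::
  "'a vfield \<Rightarrow> ('a vfield \<Rightarrow> 'a vfield \<Rightarrow> 'a vfield) \<Rightarrow> bool" where
  "tanaka_webster \<xi> nabla \<longleftrightarrow> covariant_derivative vector_fields nabla \<and>
     koszul_formula \<xi> nabla \<and>
     (\<forall>X\<in>sections_D. nabla \<xi> X =
        (\<lambda>_. 1 / 2) *\<^sub>F (lie_bracket \<xi> X - endo_app J (lie_bracket \<xi> (endo_app J X))))"

definition torsion_endo :: "'a vfield \<Rightarrow> ('a \<Rightarrow> 'a tvec \<Rightarrow> 'a tvec) \<Rightarrow> bool" where
  "torsion_endo \<xi> \<tau> \<longleftrightarrow> dist_endo \<theta> \<tau> \<and>
     (\<forall>X\<in>sections_D. \<forall>Y\<in>sections_D. webster_metric (endo_app \<tau> X) Y = webster_metric X (endo_app \<tau> Y)) \<and>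
     (\<forall>X\<in>sections_D. \<forall>Y\<in>sections_D.
        webster_metric (endo_app \<tau> X) Y = (\<lambda>p. 1 / 2 * lie_webster_metric \<xi> X Y p))"

text \<open>The partial connection \<open>S\<close> and the endomorphism \<open>\<tau>\<close> below are uniquely determined on
  \<open>\<D>\<close> by nondegeneracy of the metric.\<close>

definition adapted_connection ::
  "'a vfield \<Rightarrow> ('a vfield \<Rightarrow> 'a vfield \<Rightarrow> 'a vfield) \<Rightarrow> bool" where
  "adapted_connection \<xi> nabla \<longleftrightarrow> covariant_derivative vector_fields nabla \<and>
     (\<exists>S. schouten_connection \<xi> S \<and> (\<forall>X\<in>sections_D. \<forall>Y\<in>sections_D. nabla X Y = S X Y)) \<and>
     (\<exists>\<tau>. torsion_endo \<xi> \<tau> \<and>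
        (\<forall>X\<in>sections_D. nabla \<xi> X = lie_bracket \<xi> X + endo_app \<tau> X))"

end

end

theory Submission
  imports Defs
begin

text \<open>A vector field splits as \<open>V = H + \<theta>(V) \<xi>\<close> with \<open>H\<close> in the distribution, and both connections
  are additive and function-linear in \<open>V\<close>, so they only have to be compared on \<open>H\<close> and on \<open>\<xi>\<close>
  (\<open>tanaka_webster_eq_adapted\<close>).

  On \<open>H\<close> both satisfy the Koszul formula: one by definition, the other because a metric
  torsion-free partial connection does (\<open>schouten_koszul\<close>), and positive definiteness makes its
  solution unique (\<open>koszul_unique\<close>). The symmetry of \<open>g\<close> that this uses is partial integrability
  (\<open>webster_metric_sym\<close>).

  On \<open>\<xi>\<close> the claim is \<open>2 \<tau> X = - ([\<xi>, X] + J [\<xi>, J X])\<close>. Since \<open>\<theta>(\<xi>) = 1\<close> and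
  \<open>\<iota>\<^sub>\<xi> d\<theta> = 0\<close>, the Reeb field preserves \<open>\<theta>\<close>, hence also \<open>d\<theta>\<close> (\<open>reeb_ext_deriv\<close>). So in
  \<open>\<L>\<^sub>\<xi> g\<close>, where \<open>g = d\<theta>(\<cdot>, J \<cdot>)\<close>, only the derivative of \<open>J\<close> survives:
  \<open>(\<L>\<^sub>\<xi> g)(X, Y) = d\<theta>(X, [\<xi>, J Y] - J [\<xi>, Y]) = - g(X, [\<xi>, Y] + J [\<xi>, J Y])\<close>, the last step by
  \<open>J\<^sup>2 = - Id\<close> (\<open>lie_webster_metric_eq\<close>). The left-hand side is \<open>2 g(\<tau> X, Y) = 2 g(X, \<tau> Y)\<close>, and
  nondegeneracy of \<open>g\<close> gives the claim (\<open>torsion_endo_eq\<close>).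

  The rest is calculus on derivations: vector fields form a module over the smooth functions and a
  Lie algebra, which rests on sums and products of smooth functions being smooth.\<close>

section \<open>Closure properties of smooth functions\<close>

text \<open>On an open set the derivative depends only on the values on that set. This allows the
  derivative in the recursion for \<open>Ck_on\<close> to be replaced by an explicit formula valid on \<open>S\<close>, as
  done next.\<close>

lemma Ck_on_cong:
  assumes "open S" "\<And>x. x \<in> S \<Longrightarrow> f x = g x" "Ck_on k S f"
  shows "Ck_on k S g"
  using assms(2,3)
proof (induction k arbitrary: f g)
  case 0
  then show ?case by (simp cong: continuous_on_cong)
next
  case (Suc k)
  have der: "(g has_derivative frechet_derivative f (at x)) (at x)" if "x \<in> S" for x
    using Suc.prems that \<open>open S\<close> frechet_derivative_works has_derivative_transform_within_open
    by (metis Ck_on.simps(2))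
  have eq: "frechet_derivative f (at x) = frechet_derivative g (at x)" if "x \<in> S" for x
    using frechet_derivative_at[OF der[OF that]] .
  have "Ck_on k S (\<lambda>x. frechet_derivative g (at x) v)" for v
    by (rule Suc.IH[of "\<lambda>x. frechet_derivative f (at x) v"]) (use Suc.prems eq in auto)
  then show ?case using der by (auto simp: differentiable_def)
qed

lemma Ck_on_SucI:
  assumes "open S" "\<And>x. x \<in> S \<Longrightarrow> (f has_derivative f' x) (at x)"
    and "\<And>v. Ck_on k S (\<lambda>x. f' x v)"
  shows "Ck_on (Suc k) S f"
proof -
  have "Ck_on k S (\<lambda>x. frechet_derivative f (at x) v)" for v
    by (rule Ck_on_cong[OF assms(1) _ assms(3)[of v]])
      (use assms(2) frechet_derivative_at in metis)
  then show ?thesis using assms(2) by (auto simp: differentiable_def)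
qed

lemma Ck_on_SucD:
  assumes "Ck_on (Suc k) S f"
  shows "x \<in> S \<Longrightarrow> (f has_derivative frechet_derivative f (at x)) (at x)"
    and "Ck_on k S (\<lambda>x. frechet_derivative f (at x) v)"
  using assms by (auto simp: frechet_derivative_works)

text \<open>Needed for products, where the derivative contains the factors themselves.\<close>

lemma Ck_on_decrease:
  assumes "Ck_on (Suc k) S f"
  shows "Ck_on k S f"
  using assms
proof (induction k arbitrary: f)
  case 0
  then show ?case
    by (auto intro!: continuous_at_imp_continuous_on differentiable_imp_continuous_within)
next
  case (Suc k)
  then show ?case by (metis Ck_on.simps(2))
qed

lemma Ck_on_add:
  assumes "open S" "Ck_on k S f" "Ck_on k S g"
  shows "Ck_on k S (\<lambda>x. f x + g x)"
  using assms(2,3)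
proof (induction k arbitrary: f g)
  case 0
  then show ?case by (simp add: continuous_on_add)
next
  case (Suc k)
  show ?case
    by (rule Ck_on_SucI[OF assms(1) has_derivative_add[OF Ck_on_SucD(1)[OF Suc.prems(1)]
            Ck_on_SucD(1)[OF Suc.prems(2)]]])
      (use Suc Ck_on_SucD(2) in blast)+
qed

lemma Ck_on_mult:
  fixes f g :: "'e::real_normed_vector \<Rightarrow> real"
  assumes "open S" "Ck_on k S f" "Ck_on k S g"
  shows "Ck_on k S (\<lambda>x. f x * g x)"
  using assms(2,3)
proof (induction k arbitrary: f g)
  case 0
  then show ?case by (simp add: continuous_on_mult)
next
  case (Suc k)
  show ?case
  proof (rule Ck_on_SucI[OF assms(1) has_derivative_mult[OF Ck_on_SucD(1)[OF Suc.prems(1)]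
          Ck_on_SucD(1)[OF Suc.prems(2)]]])
    show "Ck_on k S (\<lambda>x. f x * frechet_derivative g (at x) v + frechet_derivative f (at x) v * g x)" for v
      by (intro Ck_on_add assms(1) Suc.IH Ck_on_SucD(2)[OF Suc.prems(1)] Ck_on_SucD(2)[OF Suc.prems(2)]
          Ck_on_decrease[OF Suc.prems(1)] Ck_on_decrease[OF Suc.prems(2)])
  qed
qed

lemma Ck_on_minus:
  assumes "open S" "Ck_on k S f"
  shows "Ck_on k S (\<lambda>x. - f x)"
  using assms(2)
proof (induction k arbitrary: f)
  case 0
  then show ?case by (simp add: continuous_on_minus)
next
  case (Suc k)
  show ?case
    by (rule Ck_on_SucI[OF assms(1) has_derivative_minus[OF Ck_on_SucD(1)[OF Suc.prems]]])
      (use Suc Ck_on_SucD(2) in blast)+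
qed

context smooth_manifold
begin

lemma smooth_functions_iff:
  "f \<in> smooth_functions \<longleftrightarrow> (\<forall>p. p \<notin> topspace M \<longrightarrow> f p = 0) \<and>
    (\<forall>U \<phi> k. (U, \<phi>) \<in> atlas \<longrightarrow> Ck_on k (\<phi> ` U) (\<lambda>x. f (inv_into U \<phi> x)))"
  by (auto simp: smooth_functions_def smooth_on_def o_def)

lemma chart_image_open: "(U, \<phi>) \<in> atlas \<Longrightarrow> open (\<phi> ` U)"
  using chart by blast

lemma smooth_functions_add:
  "f \<in> smooth_functions \<Longrightarrow> h \<in> smooth_functions \<Longrightarrow> f + h \<in> smooth_functions"
  by (simp add: smooth_functions_iff Ck_on_add chart_image_open)

lemma smooth_functions_mult:
  "f \<in> smooth_functions \<Longrightarrow> h \<in> smooth_functions \<Longrightarrow> f * h \<in> smooth_functions"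
  by (simp add: smooth_functions_iff Ck_on_mult chart_image_open)

lemma smooth_functions_minus:
  "f \<in> smooth_functions \<Longrightarrow> - f \<in> smooth_functions"
  by (simp add: smooth_functions_iff Ck_on_minus chart_image_open)

lemma smooth_functions_diff:
  "f \<in> smooth_functions \<Longrightarrow> h \<in> smooth_functions \<Longrightarrow> f - h \<in> smooth_functions"
  using smooth_functions_add[of f "- h"] smooth_functions_minus[of h] by simp


section \<open>The Lie algebra of vector fields\<close>

lemma vf_outside: "X \<in> vector_fields \<Longrightarrow> p \<notin> topspace M \<Longrightarrow> X p = 0"
  and vf_tangent: "X \<in> vector_fields \<Longrightarrow> p \<in> topspace M \<Longrightarrow> X p \<in> tangent_space p"
  and vf_act_smooth: "X \<in> vector_fields \<Longrightarrow> f \<in> smooth_functions \<Longrightarrow> vf_act X f \<in> smooth_functions"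
  by (auto simp: vector_fields_def)

lemma vf_nonsmooth: "X \<in> vector_fields \<Longrightarrow> f \<notin> smooth_functions \<Longrightarrow> X p f = 0"
  by (cases "p \<in> topspace M") (auto simp: vector_fields_def tangent_space_def)

lemma vf_add: 
  "X \<in> vector_fields \<Longrightarrow> f \<in> smooth_functions \<Longrightarrow> h \<in> smooth_functions \<Longrightarrow>
    X p (f + h) = X p f + X p h"
  by (cases "p \<in> topspace M") (auto simp: vector_fields_def tangent_space_def)

lemma vf_cmult: 
  "X \<in> vector_fields \<Longrightarrow> f \<in> smooth_functions \<Longrightarrow> X p (\<lambda>q. c * f q) = c * X p f"
  by (cases "p \<in> topspace M") (auto simp: vector_fields_def tangent_space_def)

lemma vf_mult: 
  "X \<in> vector_fields \<Longrightarrow> f \<in> smooth_functions \<Longrightarrow> h \<in> smooth_functions \<Longrightarrow>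
    X p (f * h) = f p * X p h + h p * X p f"
  by (cases "p \<in> topspace M") (auto simp: vector_fields_def tangent_space_def)

text \<open>If \<open>0\<close> is smooth this is homogeneity; otherwise tangent vectors vanish on it by convention.\<close>

lemma vf_zero: "X \<in> vector_fields \<Longrightarrow> X p 0 = 0"
  using vf_cmult[of X 0 p 0] vf_nonsmooth[of X 0 p] by (auto simp: zero_fun_def)

lemma vf_diff: 
  assumes "X \<in> vector_fields" "f \<in> smooth_functions" "h \<in> smooth_functions"
  shows "X p (f - h) = X p f - X p h"
  using vf_add[OF assms(1) smooth_functions_diff[OF assms(2,3)] assms(3), of p] by simp

lemma vector_fieldsI:
  assumes "\<And>p f. p \<notin> topspace M \<Longrightarrow> X p f = 0"
    and "\<And>p f. p \<in> topspace M \<Longrightarrow> f \<notin> smooth_functions \<Longrightarrow> X p f = 0"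
    and "\<And>p f h. p \<in> topspace M \<Longrightarrow> f \<in> smooth_functions \<Longrightarrow> h \<in> smooth_functions \<Longrightarrow>
           X p (f + h) = X p f + X p h"
    and "\<And>p c f. p \<in> topspace M \<Longrightarrow> f \<in> smooth_functions \<Longrightarrow> X p (\<lambda>q. c * f q) = c * X p f"
    and "\<And>p f h. p \<in> topspace M \<Longrightarrow> f \<in> smooth_functions \<Longrightarrow> h \<in> smooth_functions \<Longrightarrow>
           X p (f * h) = f p * X p h + h p * X p f"
    and "\<And>f. f \<in> smooth_functions \<Longrightarrow> vf_act X f \<in> smooth_functions"
  shows "X \<in> vector_fields"
  using assms unfolding vector_fields_def tangent_space_def by (auto simp: fun_eq_iff)

lemma vector_fields_add:
  assumes X: "X \<in> vector_fields" and Y: "Y \<in> vector_fields"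
  shows "X + Y \<in> vector_fields"
proof (rule vector_fieldsI)
  fix f assume f: "f \<in> smooth_functions"
  have "vf_act (X + Y) f = vf_act X f + vf_act Y f" by (auto simp: vf_act_def)
  then show "vf_act (X + Y) f \<in> smooth_functions"
    using f X Y by (simp add: smooth_functions_add vf_act_smooth)
qed (use X Y in \<open>simp_all add: vf_outside vf_nonsmooth vf_add vf_cmult vf_mult algebra_simps\<close>)

lemma vector_fields_scale:
  assumes u: "u \<in> smooth_functions" and X: "X \<in> vector_fields"
  shows "u *\<^sub>F X \<in> vector_fields"
proof (rule vector_fieldsI)
  fix f assume f: "f \<in> smooth_functions"
  have "vf_act (u *\<^sub>F X) f = u * vf_act X f" by (auto simp: vf_act_def vf_scale_def)
  then show "vf_act (u *\<^sub>F X) f \<in> smooth_functions"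
    using f X u by (simp add: smooth_functions_mult vf_act_smooth)
qed (use X in \<open>simp_all add: vf_scale_def vf_outside vf_nonsmooth vf_add vf_cmult vf_mult algebra_simps\<close>)

lemma vector_fields_minus:
  assumes X: "X \<in> vector_fields"
  shows "- X \<in> vector_fields"
proof (rule vector_fieldsI)
  fix f assume f: "f \<in> smooth_functions"
  have "vf_act (- X) f = - vf_act X f" by (auto simp: vf_act_def)
  then show "vf_act (- X) f \<in> smooth_functions"
    using f X by (simp add: smooth_functions_minus vf_act_smooth)
qed (use X in \<open>simp_all add: vf_outside vf_nonsmooth vf_add vf_cmult vf_mult algebra_simps\<close>)

lemma vf_act_bracket:
  "vf_act (lie_bracket X Y) f = vf_act X (vf_act Y f) - vf_act Y (vf_act X f)"
  by (auto simp: vf_act_def lie_bracket_def)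

lemma vf_act_add_right:
  "X \<in> vector_fields \<Longrightarrow> f \<in> smooth_functions \<Longrightarrow> h \<in> smooth_functions \<Longrightarrow>
    vf_act X (f + h) = vf_act X f + vf_act X h"
  by (auto simp: vf_act_def vf_add)

lemma vf_act_diff_right:
  "X \<in> vector_fields \<Longrightarrow> f \<in> smooth_functions \<Longrightarrow> h \<in> smooth_functions \<Longrightarrow>
    vf_act X (f - h) = vf_act X f - vf_act X h"
  by (auto simp: vf_act_def vf_diff)

lemma vf_act_cmult:
  "X \<in> vector_fields \<Longrightarrow> f \<in> smooth_functions \<Longrightarrow>
    vf_act X (\<lambda>q. c * f q) = (\<lambda>q. c * vf_act X f q)"
  by (auto simp: vf_act_def vf_cmult)

lemma vf_act_mult:
  "X \<in> vector_fields \<Longrightarrow> f \<in> smooth_functions \<Longrightarrow> h \<in> smooth_functions \<Longrightarrow>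
    vf_act X (f * h) = f * vf_act X h + h * vf_act X f"
  by (auto simp: vf_act_def vf_mult)

lemma vf_act_zero: "X \<in> vector_fields \<Longrightarrow> vf_act X 0 = 0"
  by (auto simp: vf_act_def vf_zero)

lemma vf_act_nonsmooth: "X \<in> vector_fields \<Longrightarrow> f \<notin> smooth_functions \<Longrightarrow> vf_act X f = 0"
  by (auto simp: vf_act_def vf_nonsmooth)

lemma vector_fields_bracket:
  assumes X: "X \<in> vector_fields" and Y: "Y \<in> vector_fields"
  shows "lie_bracket X Y \<in> vector_fields"
proof (rule vector_fieldsI)
  fix f assume f: "f \<in> smooth_functions"
  then show "vf_act (lie_bracket X Y) f \<in> smooth_functions"
    using X Y by (simp add: vf_act_bracket smooth_functions_diff vf_act_smooth)
next
  fix p f h assume fh: "f \<in> smooth_functions" "h \<in> smooth_functions"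
  show "lie_bracket X Y p (f * h) = f p * lie_bracket X Y p h + h p * lie_bracket X Y p f"
    using X Y fh
    by (simp add: lie_bracket_def vf_act_mult vf_add vf_mult smooth_functions_mult vf_act_smooth)
      (simp add: vf_act_def algebra_simps)
qed (use X Y in \<open>simp_all add: lie_bracket_def vf_outside vf_act_nonsmooth vf_zero vf_act_add_right
      vf_act_cmult vf_add vf_cmult vf_act_smooth algebra_simps fun_eq_iff\<close>)

lemma lie_bracket_add_left:
  assumes "X \<in> vector_fields" "Y \<in> vector_fields" "Z \<in> vector_fields"
  shows "lie_bracket (X + Y) Z = lie_bracket X Z + lie_bracket Y Z"
proof (intro ext)
  fix p f
  have "vf_act (X + Y) f = vf_act X f + vf_act Y f" by (auto simp: vf_act_def)
  then show "lie_bracket (X + Y) Z p f = (lie_bracket X Z + lie_bracket Y Z) p f"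
    using assms
    by (cases "f \<in> smooth_functions")
      (simp_all add: lie_bracket_def vf_add vf_act_smooth vf_act_nonsmooth vf_zero)
qed

lemma lie_bracket_swap: "lie_bracket Y X = - lie_bracket X Y"
  by (auto simp: lie_bracket_def fun_eq_iff)

text \<open>Jacobi's identity says that \<open>lie_bracket X\<close> is a derivation of the bracket; on smooth
  functions all terms are sums of threefold compositions, and on other functions all vanish.\<close>

lemma lie_bracket_jacobi:
  assumes "X \<in> vector_fields" "Y \<in> vector_fields" "Z \<in> vector_fields"
  shows "lie_bracket X (lie_bracket Y Z) =
    lie_bracket (lie_bracket X Y) Z + lie_bracket Y (lie_bracket X Z)"
proof (intro ext)
  fix p f
  show "lie_bracket X (lie_bracket Y Z) p f =
    (lie_bracket (lie_bracket X Y) Z + lie_bracket Y (lie_bracket X Z)) p f"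
  proof (cases "f \<in> smooth_functions")
    case True
    then show ?thesis using assms
      by (simp add: lie_bracket_def[of _ "lie_bracket _ _"] lie_bracket_def[of "lie_bracket _ _"]
          vf_act_bracket vf_diff vf_act_smooth) (simp add: lie_bracket_def)
  next
    case False
    then show ?thesis using assms vector_fields_bracket
      by (simp add: vf_nonsmooth)
  qed
qed


section \<open>One-forms, their exterior derivatives and their kernels\<close>

context
  fixes \<theta> :: "'a \<Rightarrow> 'a tvec \<Rightarrow> real"
  assumes \<theta>: "one_form \<theta>"
begin

lemma form_app_smooth: "X \<in> vector_fields \<Longrightarrow> form_app \<theta> X \<in> smooth_functions"
  using \<theta> by (auto simp: one_form_def)

lemma form_app_add:
  "X \<in> vector_fields \<Longrightarrow> Y \<in> vector_fields \<Longrightarrow> form_app \<theta> (X + Y) = form_app \<theta> X + form_app \<theta> Y"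
  using \<theta> by (auto simp: one_form_def form_app_def vf_tangent)

lemma form_app_scale:
  "X \<in> vector_fields \<Longrightarrow> form_app \<theta> (u *\<^sub>F X) = u * form_app \<theta> X"
  using \<theta> by (auto simp: one_form_def form_app_def vf_tangent vf_scale_def)

lemma form_app_minus:
  assumes "X \<in> vector_fields"
  shows "form_app \<theta> (- X) = - form_app \<theta> X"
proof -
  have "- X = (- 1) *\<^sub>F X" by (auto simp: vf_scale_def fun_eq_iff)
  then show ?thesis using form_app_scale[OF assms, of "- 1"] by simp
qed

lemma ext_deriv_add_left:
  assumes "X \<in> vector_fields" "Y \<in> vector_fields" "Z \<in> vector_fields"
  shows "ext_deriv \<theta> (X + Y) Z = ext_deriv \<theta> X Z + ext_deriv \<theta> Y Z"
proof -
  have "vf_act (X + Y) f = vf_act X f + vf_act Y f" for f by (auto simp: vf_act_def)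
  then show ?thesis using assms
    by (simp add: ext_deriv_def form_app_add vf_act_add_right form_app_smooth lie_bracket_add_left
        vector_fields_bracket)
qed

lemma ext_deriv_swap:
  assumes "X \<in> vector_fields" "Y \<in> vector_fields"
  shows "ext_deriv \<theta> Y X = - ext_deriv \<theta> X Y"
  using assms
  by (simp add: ext_deriv_def lie_bracket_swap[of Y X] form_app_minus vector_fields_bracket)

lemma ext_deriv_add_right:
  assumes "X \<in> vector_fields" "Y \<in> vector_fields" "Z \<in> vector_fields"
  shows "ext_deriv \<theta> Z (X + Y) = ext_deriv \<theta> Z X + ext_deriv \<theta> Z Y"
  using assms ext_deriv_swap[of _ Z] by (simp add: ext_deriv_add_left vector_fields_add)

lemma ext_deriv_minus_right:
  assumes "X \<in> vector_fields" "Y \<in> vector_fields"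
  shows "ext_deriv \<theta> X (- Y) = - ext_deriv \<theta> X Y"
proof -
  \<comment> \<open>Only additivity is used: compare \<open>(Y + Y) + (- Y)\<close> with \<open>Y\<close>.\<close>
  have *: "ext_deriv \<theta> X (Y + Y) = ext_deriv \<theta> X Y + ext_deriv \<theta> X Y"
    using assms by (intro ext_deriv_add_right)
  have "ext_deriv \<theta> X ((Y + Y) + - Y) = ext_deriv \<theta> X (Y + Y) + ext_deriv \<theta> X (- Y)"
    by (intro ext_deriv_add_right vector_fields_add vector_fields_minus assms)
  moreover have "Y + Y + - Y = Y" by (simp only: add.assoc right_minus add_0_right)
  ultimately have "ext_deriv \<theta> X Y = ext_deriv \<theta> X Y + (ext_deriv \<theta> X Y + ext_deriv \<theta> X (- Y))"
    using * by (simp only: add.assoc)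
  then show ?thesis by (simp only: add_cancel_right_right eq_neg_iff_add_eq_0 add.commute)
qed

lemma dist_sections_iff:
  "X \<in> dist_sections \<theta> \<longleftrightarrow> X \<in> vector_fields \<and> form_app \<theta> X = 0"
  by (auto simp: dist_sections_def contact_dist_def form_app_def vf_tangent fun_eq_iff)

lemma dist_sections_vf: "X \<in> dist_sections \<theta> \<Longrightarrow> X \<in> vector_fields"
  by (simp add: dist_sections_iff)

lemma dist_sections_add:
  "X \<in> dist_sections \<theta> \<Longrightarrow> Y \<in> dist_sections \<theta> \<Longrightarrow> X + Y \<in> dist_sections \<theta>"
  by (simp add: dist_sections_iff vector_fields_add form_app_add)

lemma dist_sections_minus:
  "X \<in> dist_sections \<theta> \<Longrightarrow> - X \<in> dist_sections \<theta>"
  by (simp add: dist_sections_iff vector_fields_minus form_app_minus)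

lemma dist_sections_diff:
  "X \<in> dist_sections \<theta> \<Longrightarrow> Y \<in> dist_sections \<theta> \<Longrightarrow> X - Y \<in> dist_sections \<theta>"
  using dist_sections_add[of X "- Y"] dist_sections_minus by simp

lemma ext_deriv_dist_sections:
  assumes "X \<in> dist_sections \<theta>" "Y \<in> dist_sections \<theta>"
  shows "ext_deriv \<theta> X Y = - form_app \<theta> (lie_bracket X Y)"
  using assms by (simp add: ext_deriv_def dist_sections_iff vf_act_zero)


section \<open>The Reeb field preserves the contact structure\<close>

context
  fixes \<xi> :: "'a vfield"
  assumes \<xi>: "reeb_field \<theta> \<xi>"
begin

lemma reeb_vf: "\<xi> \<in> vector_fields"
  using \<xi> by (simp add: reeb_field_def)

text \<open>\<open>\<theta>(\<xi>)\<close> is the constant \<open>1\<close> on the manifold, that is, an idempotent \<open>e\<close> of the ring of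
  smooth functions; the Leibniz rule gives \<open>X e = 2 e (X e)\<close>, so \<open>X e = 0\<close> wherever \<open>e = 1\<close>.\<close>

lemma vf_act_form_reeb:
  assumes X: "X \<in> vector_fields"
  shows "vf_act X (form_app \<theta> \<xi>) = 0"
proof
  fix p
  let ?e = "form_app \<theta> \<xi>"
  have e: "?e q = (if q \<in> topspace M then 1 else 0)" for q
    using \<xi> by (auto simp: reeb_field_def form_app_def)
  then have "?e * ?e = ?e" by (auto simp: fun_eq_iff)
  then have "X p ?e = 2 * (?e p * X p ?e)"
    using vf_mult[OF X form_app_smooth form_app_smooth, OF reeb_vf reeb_vf, of p] by simp
  then show "vf_act X ?e p = 0 p"
    using e[of p] vf_outside[OF X, of p] by (auto simp: vf_act_def split: if_splits)
qed

text \<open>Invariance of \<open>\<theta>\<close> under the Reeb flow: this is Cartan's formula with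
  \<open>\<theta>(\<xi>)\<close> constant and \<open>\<iota>\<^sub>\<xi> d\<theta> = 0\<close>.\<close>

lemma form_app_reeb_bracket:
  assumes X: "X \<in> vector_fields"
  shows "form_app \<theta> (lie_bracket \<xi> X) = vf_act \<xi> (form_app \<theta> X)"
proof -
  have "ext_deriv \<theta> \<xi> X = 0" using \<xi> X by (simp add: reeb_field_def)
  then show ?thesis using vf_act_form_reeb[OF X] by (simp add: ext_deriv_def)
qed

lemma reeb_bracket_dist_sections:
  "X \<in> dist_sections \<theta> \<Longrightarrow> lie_bracket \<xi> X \<in> dist_sections \<theta>"
  by (simp add: dist_sections_iff form_app_reeb_bracket vf_act_zero reeb_vf vector_fields_bracket)

text \<open>The equation \<open>\<L>\<^sub>\<xi> d\<theta> = 0\<close> on the distribution. There \<open>d\<theta>(X, Y) = - \<theta>([X, Y])\<close>, so it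
  is the Jacobi identity under the invariant form \<open>\<theta>\<close>.\<close>

lemma reeb_ext_deriv:
  assumes X: "X \<in> dist_sections \<theta>" and Y: "Y \<in> dist_sections \<theta>"
  shows "vf_act \<xi> (ext_deriv \<theta> X Y) =
    ext_deriv \<theta> (lie_bracket \<xi> X) Y + ext_deriv \<theta> X (lie_bracket \<xi> Y)"
proof -
  note vf = dist_sections_vf[OF X] dist_sections_vf[OF Y] reeb_vf
  note XY = vector_fields_bracket[OF vf(1,2)]
  have "vf_act \<xi> (ext_deriv \<theta> X Y) = vf_act \<xi> (form_app \<theta> (- lie_bracket X Y))"
    by (simp add: ext_deriv_dist_sections[OF X Y] form_app_minus XY)
  also have "\<dots> = vf_act \<xi> (form_app \<theta> (lie_bracket Y X))"
    by (simp add: lie_bracket_swap[of Y X])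
  also have "\<dots> = form_app \<theta> (lie_bracket \<xi> (lie_bracket Y X))"
    using vf by (simp add: form_app_reeb_bracket vector_fields_bracket)
  also have "\<dots> = form_app \<theta> (lie_bracket (lie_bracket \<xi> Y) X) + form_app \<theta> (lie_bracket Y (lie_bracket \<xi> X))"
    unfolding lie_bracket_jacobi[OF vf(3,2,1)]
    by (intro form_app_add vector_fields_bracket vf)
  also have "\<dots> = - ext_deriv \<theta> (lie_bracket \<xi> Y) X - ext_deriv \<theta> Y (lie_bracket \<xi> X)"
    using X Y by (simp add: ext_deriv_dist_sections reeb_bracket_dist_sections)
  also have "\<dots> = ext_deriv \<theta> (lie_bracket \<xi> X) Y + ext_deriv \<theta> X (lie_bracket \<xi> Y)"
    using ext_deriv_swap[OF vf(1) vector_fields_bracket[OF vf(3,2)]]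
      ext_deriv_swap[OF vector_fields_bracket[OF vf(3,1)] vf(2)] by simp
  finally show ?thesis .
qed

lemma dist_proj_dist_sections:
  assumes V: "V \<in> vector_fields"
  shows "dist_proj \<theta> \<xi> V \<in> dist_sections \<theta>"
proof -
  let ?u = "form_app \<theta> V"
  have s: "?u *\<^sub>F \<xi> \<in> vector_fields"
    by (simp add: vector_fields_scale form_app_smooth V reeb_vf)
  have "?u * form_app \<theta> \<xi> = ?u"
    using \<xi> by (auto simp: reeb_field_def form_app_def)
  then have "form_app \<theta> (V + - (?u *\<^sub>F \<xi>)) = 0"
    using form_app_add[OF V vector_fields_minus[OF s]]
    by (simp only: form_app_minus[OF s] form_app_scale[OF reeb_vf] right_minus)
  then show ?thesis
    using vector_fields_add[OF V vector_fields_minus[OF s]]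
    by (simp add: dist_sections_iff dist_proj_def)
qed

end

end

end


section \<open>The Webster metric and the two connections\<close>

context pseudo_hermitian_manifold
begin

lemma theta_one_form: "one_form \<theta>"
  using contact by (simp add: contact_form_def)

lemmas D_simps = dist_sections_add[OF theta_one_form] dist_sections_minus[OF theta_one_form]
  dist_sections_diff[OF theta_one_form] dist_sections_vf[OF theta_one_form]

lemma J_section: "X \<in> sections_D \<Longrightarrow> endo_app J X \<in> sections_D"
  using J_endo by (simp add: dist_endo_def)

lemma J_add:
  "X \<in> sections_D \<Longrightarrow> Y \<in> sections_D \<Longrightarrow> endo_app J (X + Y) = endo_app J X + endo_app J Y"
  using J_endo by (auto simp: dist_endo_def dist_sections_def endo_app_def fun_eq_iff)

lemma J_J: "X \<in> sections_D \<Longrightarrow> endo_app J (endo_app J X) = - X"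
  using J_square vf_outside[of X]
  by (auto simp: dist_sections_def endo_app_def fun_eq_iff)

text \<open>By partial integrability \<open>d\<theta>(X, JY) + d\<theta>(JX, Y) = - \<theta>([X, JY] + [JX, Y]) = 0\<close>.\<close>

lemma webster_metric_sym:
  assumes X: "X \<in> sections_D" and Y: "Y \<in> sections_D"
  shows "webster_metric X Y = webster_metric Y X"
proof -
  note vf = D_simps(4)[OF X] D_simps(4)[OF Y] D_simps(4)[OF J_section[OF X]] D_simps(4)[OF J_section[OF Y]]
  have "form_app \<theta> (lie_bracket X (endo_app J Y)) + form_app \<theta> (lie_bracket (endo_app J X) Y) = 0"
    using partially_integrable[OF X Y] vf
    by (simp add: dist_sections_iff[OF theta_one_form] form_app_add[OF theta_one_form] vector_fields_bracket)
  then have "ext_deriv \<theta> X (endo_app J Y) + ext_deriv \<theta> (endo_app J X) Y = 0"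
    using X Y by (simp add: ext_deriv_dist_sections[OF theta_one_form] J_section
        add_eq_0_iff)
  then show ?thesis
    using ext_deriv_swap[OF theta_one_form vf(2,3)] by (simp add: webster_metric_def)
qed

lemma webster_metric_add_left:
  "X \<in> sections_D \<Longrightarrow> Y \<in> sections_D \<Longrightarrow> Z \<in> sections_D \<Longrightarrow>
    webster_metric (X + Y) Z = webster_metric X Z + webster_metric Y Z"
  by (simp add: webster_metric_def ext_deriv_add_left[OF theta_one_form] D_simps J_section)

lemma webster_metric_diff_left:
  "X \<in> sections_D \<Longrightarrow> Y \<in> sections_D \<Longrightarrow> Z \<in> sections_D \<Longrightarrow>
    webster_metric (X - Y) Z = webster_metric X Z - webster_metric Y Z"
  using webster_metric_add_left[of "X - Y" Y Z] by (simp add: D_simps)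

text \<open>Test against \<open>Z = X\<close>.\<close>

lemma webster_metric_nondegenerate:
  assumes X: "X \<in> sections_D" and 0: "\<And>Z. Z \<in> sections_D \<Longrightarrow> webster_metric X Z = 0"
  shows "X = 0"
proof
  fix p
  show "X p = 0 p"
    using positive_definite[OF X, of p] 0[OF X] vf_outside[OF D_simps(4)[OF X], of p]
    by (cases "p \<in> topspace M"; cases "X p = 0") (auto simp: webster_metric_def)
qed

lemma webster_metric_eqI:
  assumes "X \<in> sections_D" "Y \<in> sections_D"
    and "\<And>Z. Z \<in> sections_D \<Longrightarrow> webster_metric X Z = webster_metric Y Z"
  shows "X = Y"
  using webster_metric_nondegenerate[of "X - Y"] assms
  by (simp add: webster_metric_diff_left D_simps)

text \<open>Christoffel's computation: express all six terms by the connection, using metricity for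
  the derivatives and vanishing torsion for the brackets; by symmetry of \<open>g\<close> everything cancels except
  twice \<open>g(S X Y, Z)\<close>.\<close>

lemma schouten_koszul:
  assumes S: "schouten_connection \<xi> S"
  shows "koszul_formula \<xi> S"
  unfolding koszul_formula_def
proof (intro ballI)
  fix X Y Z assume D: "X \<in> sections_D" "Y \<in> sections_D" "Z \<in> sections_D"
  have SD: "S A B \<in> sections_D" if "A \<in> sections_D" "B \<in> sections_D" for A B
    using S that by (simp add: schouten_connection_def covariant_derivative_def)
  have metric: "vf_act A (webster_metric B C) = webster_metric (S A B) C + webster_metric (S A C) B"
    if "A \<in> sections_D" "B \<in> sections_D" "C \<in> sections_D" for A B C
    using S that webster_metric_sym[of B "S A C"] SD by (simp add: schouten_connection_def)
  have proj: "dist_proj \<theta> \<xi> (lie_bracket A B) = S A B - S B A"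
    if "A \<in> sections_D" "B \<in> sections_D" for A B
    using S that by (simp add: schouten_connection_def)
  show "2 * webster_metric (S X Y) Z =
          vf_act X (webster_metric Y Z) + vf_act Y (webster_metric Z X) - vf_act Z (webster_metric X Y)
          + webster_metric (dist_proj \<theta> \<xi> (lie_bracket X Y)) Z
          - webster_metric (dist_proj \<theta> \<xi> (lie_bracket Y Z)) X
          - webster_metric (dist_proj \<theta> \<xi> (lie_bracket X Z)) Y"
    using D by (simp add: metric proj webster_metric_diff_left SD)
qed

text \<open>The right-hand side of the formula does not mention the connection, and \<open>g(\<cdot>, Z)\<close> for all \<open>Z\<close>
  determines a section.\<close>

lemma koszul_unique:
  assumes "koszul_formula \<xi> nabla" "koszul_formula \<xi> nabla'"
    and "X \<in> sections_D" "Y \<in> sections_D"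
    and "nabla X Y \<in> sections_D" "nabla' X Y \<in> sections_D"
  shows "nabla X Y = nabla' X Y"
proof (rule webster_metric_eqI)
  fix Z assume Z: "Z \<in> sections_D"
  have "2 * webster_metric (nabla X Y) Z = 2 * webster_metric (nabla' X Y) Z"
    using assms(1-4) Z by (simp add: koszul_formula_def)
  then show "webster_metric (nabla X Y) Z = webster_metric (nabla' X Y) Z"
    by (simp add: fun_eq_iff)
qed (use assms in auto)

text \<open>As \<open>\<L>\<^sub>\<xi> d\<theta> = 0\<close>, the Lie derivative of \<open>g = d\<theta>(\<cdot>, J \<cdot>)\<close> is
  \<open>d\<theta>(X, [\<xi>, J Y]) - g(X, [\<xi>, Y])\<close>; the first term is written through \<open>g\<close> by means of
  \<open>B = - J (J B)\<close>.\<close>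

lemma lie_webster_metric_eq:
  assumes \<xi>: "reeb_field \<theta> \<xi>" and X: "X \<in> sections_D" and Y: "Y \<in> sections_D"
  shows "lie_webster_metric \<xi> X Y =
    - webster_metric (lie_bracket \<xi> Y + endo_app J (lie_bracket \<xi> (endo_app J Y))) X"
proof -
  note br = reeb_bracket_dist_sections[OF theta_one_form \<xi>]
  let ?B = "lie_bracket \<xi> (endo_app J Y)"
  have B: "?B \<in> sections_D" by (simp add: br J_section Y)
  have "webster_metric X (endo_app J ?B) = ext_deriv \<theta> X (- ?B)"
    by (simp add: webster_metric_def J_J B)
  also have "\<dots> = - ext_deriv \<theta> X ?B"
    using X B by (simp add: ext_deriv_minus_right[OF theta_one_form] D_simps)
  finally have JB: "ext_deriv \<theta> X ?B = - webster_metric X (endo_app J ?B)" by simp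
  have "lie_webster_metric \<xi> X Y = ext_deriv \<theta> X ?B - webster_metric X (lie_bracket \<xi> Y)"
    using reeb_ext_deriv[OF theta_one_form \<xi> X J_section[OF Y]]
    by (simp add: lie_webster_metric_def webster_metric_def)
  also have "\<dots> = - (webster_metric (lie_bracket \<xi> Y) X + webster_metric (endo_app J ?B) X)"
    using X Y B by (simp add: JB webster_metric_sym[of X] br J_section)
  finally show ?thesis
    using X Y B by (simp add: webster_metric_add_left br J_section)
qed

text \<open>Pairing with an arbitrary section \<open>Z\<close> turns this into the formula for \<open>\<L>\<^sub>\<xi> g\<close>. The factor
  \<open>2\<close> is written as a sum so that closure of the sections under addition is enough.\<close>

lemma torsion_endo_eq:
  assumes \<xi>: "reeb_field \<theta> \<xi>" and \<tau>: "torsion_endo \<xi> \<tau>" and X: "X \<in> sections_D"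
  shows "endo_app \<tau> X + endo_app \<tau> X =
    - (lie_bracket \<xi> X + endo_app J (lie_bracket \<xi> (endo_app J X)))"
proof -
  note br = reeb_bracket_dist_sections[OF theta_one_form \<xi>]
  let ?W = "lie_bracket \<xi> X + endo_app J (lie_bracket \<xi> (endo_app J X))"
  have \<tau>D: "endo_app \<tau> Z \<in> sections_D" if "Z \<in> sections_D" for Z
    using \<tau> that unfolding torsion_endo_def dist_endo_def by blast
  have W: "?W \<in> sections_D" by (intro D_simps br J_section X)
  have "(endo_app \<tau> X + endo_app \<tau> X) + ?W = 0"
  proof (rule webster_metric_nondegenerate)
    fix Z assume Z: "Z \<in> sections_D"
    \<comment> \<open>The formula for \<open>\<L>\<^sub>\<xi> g\<close> applies the operator to its second argument, so \<open>X\<close> is moved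
      there by the symmetry of \<open>\<tau>\<close>.\<close>
    have "webster_metric (endo_app \<tau> X) Z = webster_metric (endo_app \<tau> Z) X"
      using \<tau> X Z webster_metric_sym[OF X \<tau>D[OF Z]] unfolding torsion_endo_def by metis
    also have "\<dots> = (\<lambda>p. 1 / 2 * lie_webster_metric \<xi> Z X p)"
      using \<tau> X Z unfolding torsion_endo_def by blast
    also have "\<dots> = (\<lambda>p. - (1 / 2) * webster_metric ?W Z p)"
      by (simp add: lie_webster_metric_eq[OF \<xi> Z X])
    finally have eq: "webster_metric (endo_app \<tau> X) Z = (\<lambda>p. - (1 / 2) * webster_metric ?W Z p)" .
    have "webster_metric (endo_app \<tau> X + endo_app \<tau> X + ?W) Z =
      webster_metric (endo_app \<tau> X) Z + webster_metric (endo_app \<tau> X) Z + webster_metric ?W Z"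
      by (simp only: webster_metric_add_left[OF D_simps(1)[OF \<tau>D[OF X] \<tau>D[OF X]] W Z]
          webster_metric_add_left[OF \<tau>D[OF X] \<tau>D[OF X] Z])
    then show "webster_metric (endo_app \<tau> X + endo_app \<tau> X + ?W) Z = 0"
      by (simp only: eq) (simp add: fun_eq_iff)
  qed (rule D_simps(1)[OF D_simps(1)[OF \<tau>D[OF X] \<tau>D[OF X]] W])
  then show ?thesis by (simp only: eq_neg_iff_add_eq_0)
qed

lemma tanaka_webster_eq_adapted:
  assumes \<xi>: "reeb_field \<theta> \<xi>" and TW: "tanaka_webster \<xi> nabla" and AD: "adapted_connection \<xi> nabla'"
    and V: "V \<in> vector_fields" and X: "X \<in> sections_D"
  shows "nabla V X = nabla' V X"
proof -
  have cov: "covariant_derivative vector_fields nabla" "covariant_derivative vector_fields nabla'"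
    using TW AD unfolding tanaka_webster_def adapted_connection_def by blast+
  have horizontal: "nabla H X = nabla' H X" if H: "H \<in> sections_D" for H
  proof -
    obtain S where S: "schouten_connection \<xi> S" "\<forall>X\<in>sections_D. \<forall>Y\<in>sections_D. nabla' X Y = S X Y"
      using AD unfolding adapted_connection_def by blast
    have "nabla H X = S H X"
    proof (rule koszul_unique[OF _ schouten_koszul[OF S(1)] H X])
      show "koszul_formula \<xi> nabla" using TW unfolding tanaka_webster_def by blast
      show "nabla H X \<in> sections_D"
        using cov(1) D_simps(4)[OF H] X unfolding covariant_derivative_def by blast
      show "S H X \<in> sections_D"
        using S(1) H X unfolding schouten_connection_def covariant_derivative_def by blast
    qed
    then show ?thesis using S(2) H X by simp
  qed
  have vertical: "nabla \<xi> X = nabla' \<xi> X"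
  proof -
    obtain \<tau> where \<tau>: "torsion_endo \<xi> \<tau>" "nabla' \<xi> X = lie_bracket \<xi> X + endo_app \<tau> X"
      using AD X unfolding adapted_connection_def by blast
    let ?B = "lie_bracket \<xi> X" and ?C = "endo_app J (lie_bracket \<xi> (endo_app J X))"
    have "nabla \<xi> X p h = nabla' \<xi> X p h" for p h
    proof -
      have "nabla \<xi> X p h = 1 / 2 * (?B p h - ?C p h)"
        using TW X unfolding tanaka_webster_def by (simp add: vf_scale_def)
      moreover have "endo_app \<tau> X p h + endo_app \<tau> X p h = - (?B p h + ?C p h)"
        using torsion_endo_eq[OF \<xi> \<tau>(1) X] by (simp add: fun_eq_iff)
      ultimately show ?thesis by (simp add: \<tau>(2))
    qed
    then show ?thesis by (intro ext)
  qed
  let ?H = "dist_proj \<theta> \<xi> V" and ?u = "form_app \<theta> V"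
  have H: "?H \<in> sections_D"
    by (rule dist_proj_dist_sections[OF theta_one_form \<xi> V])
  have u: "?u \<in> smooth_functions" by (rule form_app_smooth[OF theta_one_form V])
  have r: "\<xi> \<in> vector_fields" by (rule reeb_vf[OF theta_one_form \<xi>])
  have split: "N V X = N ?H X + ?u *\<^sub>F N \<xi> X" if "covariant_derivative vector_fields N" for N
  proof -
    have "N (?H + ?u *\<^sub>F \<xi>) X = N ?H X + N (?u *\<^sub>F \<xi>) X"
      using that D_simps(4)[OF H] vector_fields_scale[OF u r] X
      unfolding covariant_derivative_def by blast
    moreover have "N (?u *\<^sub>F \<xi>) X = ?u *\<^sub>F N \<xi> X"
      using that u r X unfolding covariant_derivative_def by blast
    ultimately show ?thesis by (simp add: dist_proj_def)
  qed
  show ?thesis using split[OF cov(1)] split[OF cov(2)] horizontal[OF H] vertical by simp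
qed

end

theorem proposition4p1:
  fixes M :: "'a topology"
    and atlas :: "('a set \<times> ('a \<Rightarrow> 'e::euclidean_space)) set"
    and m :: nat
    and \<theta> :: "'a \<Rightarrow> 'a tvec \<Rightarrow> real"
    and J :: "'a \<Rightarrow> 'a tvec \<Rightarrow> 'a tvec"
    and \<xi> :: "'a vfield"
    and nabla_TW nabla_tau :: "'a vfield \<Rightarrow> 'a vfield \<Rightarrow> 'a vfield"
  assumes "pseudo_hermitian_manifold M atlas m \<theta> J"
    and "smooth_manifold.reeb_field M atlas \<theta> \<xi>"
    and "pseudo_hermitian_manifold.tanaka_webster M atlas \<theta> J \<xi> nabla_TW"
    and "pseudo_hermitian_manifold.adapted_connection M atlas \<theta> J \<xi> nabla_tau"
  shows "\<forall>V\<in>smooth_manifold.vector_fields M atlas. \<forall>X\<in>smooth_manifold.dist_sections M atlas \<theta>.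
           nabla_TW V X = nabla_tau V X"
  using pseudo_hermitian_manifold.tanaka_webster_eq_adapted[OF assms] by blast

end
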